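(* Let $k\ge1$, let $(\varphi_j)_{j\ge0}$ be non-negative numbers with $\varphi_0>0$, and for $n\ge1$ let $T_n=\sum_{T\in\mathcal{O}(n)}\big(\prod_{v\in T}\varphi_{\mathrm{outdeg}(v)}\big)\,|\mathcal{L}^{[k]}(T)|$, where $|\mathcal{L}^{[k]}(T)|$ is the number of increasing $k$-labellings of $T$ with label set $\{1,\dots,kn\}$. Then \[\sum_{T\in\mathcal{O}(n)}\prod_{v\in T}\left(\frac{\varphi_{\mathrm{outdeg}(v)}}{(kh_v)^{\underline{k}}}\right)=\frac{T_n}{(kn)!}.\]
   Context: $\mathcal{O}(n)$ is the set of ordered (planted plane) rooted trees with $n$ nodes; $\mathrm{outdeg}(v)$ is the number of children of $v$; $h_v$ is the number of descendants of $v$ including $v$. An increasing $k$-labelling of a tree with $n$ nodes assigns to each node a set of exactly $k$ integers from $\{1,\dots,kn\}$, these sets partitioning $\{1,\dots,kn\}$, such that every label of a child is larger than every label of its parent. $x^{\underline{s}}=x(x-1)\cdots(x-s+1)$. *)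

theory Defs
  imports Complex_Main "HOL-Library.Sublist" "HOL-Library.FuncSet" "HOL-Library.Disjoint_Sets"
begin

datatype otree = Node (children: "otree list")

text \<open>A node is represented by its path from the root: the root is the empty path, and
  \<open>v @ [i]\<close> is the \<open>i\<close>-th child (counted from 0) of \<open>v\<close>.\<close>

primrec nodes :: "otree \<Rightarrow> nat list set" where
  "nodes (Node ts) = insert [] (\<Union>i<length ts. (#) i ` (map nodes ts ! i))"

primrec subtree_at :: "otree \<Rightarrow> nat list \<Rightarrow> otree" where
  "subtree_at t [] = t"
| "subtree_at t (i # v) = subtree_at (children t ! i) v"

definition outdeg :: "otree \<Rightarrow> nat list \<Rightarrow> nat" where
  "outdeg t v = length (children (subtree_at t v))"

definition num_desc :: "otree \<Rightarrow> nat list \<Rightarrow> nat" where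
  "num_desc t v = card {w \<in> nodes t. prefix v w}"

definition ordered_trees :: "nat \<Rightarrow> otree set" where
  "ordered_trees n = {t. card (nodes t) = n}"

text \<open>Labellings are extensional (\<open>undefined\<close> off the node set), so that each one is counted
  exactly once.\<close>

definition increasing_labellings :: "nat \<Rightarrow> otree \<Rightarrow> (nat list \<Rightarrow> nat set) set" where
  "increasing_labellings k t =
    {L \<in> nodes t \<rightarrow>\<^sub>E {A. A \<subseteq> {1..k * card (nodes t)} \<and> card A = k}.
       disjoint_family_on L (nodes t) \<and>
       (\<Union>v\<in>nodes t. L v) = {1..k * card (nodes t)} \<and>
       (\<forall>v i. v @ [i] \<in> nodes t \<longrightarrow> (\<forall>a\<in>L v. \<forall>b\<in>L (v @ [i]). a < b))}"

definition total_weight :: "nat \<Rightarrow> (nat \<Rightarrow> real) \<Rightarrow> nat \<Rightarrow> real" where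
  "total_weight k \<phi> n =
    (\<Sum>t\<in>ordered_trees n. (\<Prod>v\<in>nodes t. \<phi> (outdeg t v)) * real (card (increasing_labellings k t)))"

definition falling_fact :: "real \<Rightarrow> nat \<Rightarrow> real" where
  "falling_fact x s = (\<Prod>i<s. x - real i)"

lemma finite_nodes: "finite (nodes t)"
  by (induction t) simp

lemma card_nodes_child_less:
  "s \<in> set ts \<Longrightarrow> card (nodes s) < card (nodes (Node ts))"
proof -
  assume "s \<in> set ts"
  then obtain i where i: "i < length ts" "s = ts ! i" by (auto simp: in_set_conv_nth)
  have "card (nodes s) = card ((#) i ` nodes s)" by (simp add: card_image)
  also have "\<dots> < card (nodes (Node ts))"
  proof (rule psubset_card_mono[OF finite_nodes])
    have "(#) i ` nodes s \<subseteq> nodes (Node ts)" using i by auto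
    moreover have "[] \<in> nodes (Node ts)" "[] \<notin> (#) i ` nodes s" by auto
    ultimately show "(#) i ` nodes s \<subset> nodes (Node ts)" by blast
  qed
  finally show ?thesis .
qed

lemma length_less_card_nodes: "length ts < card (nodes (Node ts))"
proof -
  have root: "[] \<in> nodes s" for s by (cases s) simp
  have "card (insert [] ((\<lambda>i. [i]) ` {..<length ts})) \<le> card (nodes (Node ts))"
  proof (rule card_mono[OF finite_nodes], rule subsetI)
    fix x assume "x \<in> insert [] ((\<lambda>i. [i]) ` {..<length ts})"
    then consider "x = []" | i where "i < length ts" "x = [i]" by blast
    then show "x \<in> nodes (Node ts)"
    proof cases
      case 2
      then have "x \<in> (#) i ` (map nodes ts ! i)" using root by simp
      then show ?thesis using 2 by auto
    qed simp
  qed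
  moreover have "card (insert [] ((\<lambda>i. [i]) ` {..<length ts})) = Suc (length ts)"
    by (subst card_insert_disjoint) (auto simp: card_image inj_on_def)
  ultimately show ?thesis by simp
qed

text \<open>The index set of the sums is finite, so these sums are not the default value 0.\<close>

lemma finite_ordered_trees: "finite (ordered_trees n)"
proof -
  have "finite {t. card (nodes t) < m}" for m
  proof (induction m)
    case (Suc m)
    let ?S = "{t. card (nodes t) < m}"
    have "{t. card (nodes t) < Suc m} \<subseteq> Node ` {ts. set ts \<subseteq> ?S \<and> length ts \<le> m}"
    proof
      fix t assume t: "t \<in> {t. card (nodes t) < Suc m}"
      obtain ts where ts: "t = Node ts" by (cases t)
      show "t \<in> Node ` {ts. set ts \<subseteq> ?S \<and> length ts \<le> m}"
      proof (unfold ts, intro imageI CollectI conjI subsetI)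
        fix s assume "s \<in> set ts"
        from card_nodes_child_less[OF this] t show "card (nodes s) < m" unfolding ts by simp
      next
        from length_less_card_nodes[of ts] t show "length ts \<le> m" unfolding ts by simp
      qed
    qed
    then show ?case
      using finite_lists_length_le[OF Suc.IH] finite_surj by blast
  qed simp
  from this[of "Suc n"] show ?thesis
    unfolding ordered_trees_def by (rule rev_finite_subset) auto
qed

lemma finite_increasing_labellings: "finite (increasing_labellings k t)"
proof -
  have "finite (nodes t \<rightarrow>\<^sub>E {A. A \<subseteq> {1..k * card (nodes t)} \<and> card A = k})"
    by (intro finite_PiE finite_nodes) simp
  then show ?thesis
    unfolding increasing_labellings_def by (rule rev_finite_subset) auto
qed

end

theory Submission imports Defs begin

text \<open>The theorem is the sum over all trees of the hook length formula: the number of increasing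
  \<open>k\<close>-labellings times the product over all nodes of the falling factorials is \<open>(kn)!\<close>. Trees enter
  only through the prefix order on their sets of paths, and the formula holds for every finite set
  \<open>N\<close> of lists ordered by prefix. Let \<open>r\<close> be an element of \<open>N\<close> of minimal length. If \<open>r\<close> is a prefix
  of everything, its labels are forced to be the \<open>k\<close> smallest ones, which accounts for the factor of
  \<open>r\<close>. Otherwise \<open>N\<close> splits into the elements above \<open>r\<close> and the remaining ones; these two parts are
  incomparable, and the labels are distributed between them in a binomial number of ways.\<close>

section \<open>Labellings of finite sets of lists under the prefix order\<close>

text \<open>The label set \<open>S\<close> is arbitrary because the recursion hands arbitrary
  subsets of the labels to smaller pieces. The order condition runs over all strict prefixes, not
  only over parents and children, since a subset of a tree may lose the nodes in between.\<close>

definition prefix_labellings :: "nat \<Rightarrow> 'a list set \<Rightarrow> nat set \<Rightarrow> ('a list \<Rightarrow> nat set) set" where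
  "prefix_labellings k N S =
    {L \<in> N \<rightarrow>\<^sub>E {A. A \<subseteq> S \<and> card A = k}.
       disjoint_family_on L N \<and> (\<Union>v\<in>N. L v) = S \<and>
       (\<forall>v\<in>N. \<forall>w\<in>N. strict_prefix v w \<longrightarrow> (\<forall>a\<in>L v. \<forall>b\<in>L w. a < b))}"

lemma finite_prefix_labellings:
  assumes "finite N" "finite S"
  shows "finite (prefix_labellings k N S)"
proof -
  have "finite (N \<rightarrow>\<^sub>E {A. A \<subseteq> S \<and> card A = k})"
    using assms by (intro finite_PiE) auto
  then show ?thesis
    unfolding prefix_labellings_def by (rule rev_finite_subset) auto
qed

lemma prefix_labellings_undefined:
  "L \<in> prefix_labellings k N S \<Longrightarrow> v \<notin> N \<Longrightarrow> L v = undefined"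
  unfolding prefix_labellings_def by (blast dest: PiE_arb)

lemma restrict_prefix_labellings:
  assumes L: "L \<in> prefix_labellings k N S" and "M \<subseteq> N"
  shows "restrict L M \<in> prefix_labellings k M (\<Union>v\<in>M. L v)"
proof -
  have "card (L v) = k" if "v \<in> M" for v
    using L that \<open>M \<subseteq> N\<close> unfolding prefix_labellings_def by (blast dest: PiE_mem)
  then have "restrict L M \<in> M \<rightarrow>\<^sub>E {A. A \<subseteq> (\<Union>v\<in>M. L v) \<and> card A = k}"
    by auto
  moreover have "disjoint_family_on (restrict L M) M"
    using L \<open>M \<subseteq> N\<close> by (simp add: prefix_labellings_def disjoint_family_on_def subset_eq)
  moreover have "a < b" if "v \<in> M" "w \<in> M" "strict_prefix v w" "a \<in> L v" "b \<in> L w" for v w a b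
    using L that \<open>M \<subseteq> N\<close> unfolding prefix_labellings_def by blast
  ultimately show ?thesis unfolding prefix_labellings_def by simp
qed

section \<open>Falling factorials and initial segments\<close>

text \<open>This is the factor contributed by a least element when its \<open>k\<close> labels are
  removed. Each new factor \<open>m - k\<close> of the falling factorial is split off from
  \<open>fact (m - k)\<close>.\<close>

lemma falling_fact_mult_fact:
  assumes "k \<le> m"
  shows "falling_fact (real m) k * fact (m - k) = fact m"
  using assms
proof (induction k)
  case 0
  then show ?case by (simp add: falling_fact_def)
next
  case (Suc k)
  have "fact (m - k) = (real m - real k) * fact (m - Suc k)"
    using Suc.prems fact_reduce[of "m - k", where 'a = real] by (simp add: of_nat_diff)
  then have "falling_fact (real m) (Suc k) * fact (m - Suc k) =
      falling_fact (real m) k * fact (m - k)"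
    by (simp add: falling_fact_def)
  then show ?case using Suc by simp
qed

text \<open>Built greedily: the minimum of the remaining elements is added until there are
  \<open>k\<close> of them.\<close>

lemma exists_initial_segment:
  fixes S :: "'a::linorder set"
  assumes "finite S" "k \<le> card S"
  shows "\<exists>U\<subseteq>S. card U = k \<and> (\<forall>a\<in>U. \<forall>b\<in>S - U. a < b)"
  using assms
proof (induction k)
  case 0
  then show ?case by auto
next
  case (Suc k)
  then obtain U where U: "U \<subseteq> S" "card U = k" "\<forall>a\<in>U. \<forall>b\<in>S - U. a < b"
    by auto
  have fin: "finite U" "finite (S - U)" using U Suc.prems finite_subset by auto
  have ne: "S - U \<noteq> {}"
    using U Suc.prems by (metis Diff_eq_empty_iff card_mono fin(1) not_less_eq_eq)
  define m where "m = Min (S - U)"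
  have m: "m \<in> S - U" "\<And>b. b \<in> S - U \<Longrightarrow> m \<le> b"
    unfolding m_def using fin ne Min_in by auto
  have "insert m U \<subseteq> S" "card (insert m U) = Suc k"
    using m U fin by auto
  moreover have "\<forall>a\<in>insert m U. \<forall>b\<in>S - insert m U. a < b"
    using m(2) U(3) by (auto simp: order.strict_iff_order)
  ultimately show ?case by blast
qed

text \<open>Of two different finite sets of equal size, each has an element that the other lacks;
  each of these two elements would have to be smaller than the other.\<close>

lemma initial_segment_unique:
  fixes S :: "'a::linorder set"
  assumes "finite S" "U \<subseteq> S" "V \<subseteq> S" "card U = card V"
    and "\<forall>a\<in>U. \<forall>b\<in>S - U. a < b" "\<forall>a\<in>V. \<forall>b\<in>S - V. a < b"
  shows "U = V"
proof (rule ccontr)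
  assume neq: "U \<noteq> V"
  have fin: "finite U" "finite V" using assms(1-3) finite_subset by blast+
  have "\<not> U \<subseteq> V" "\<not> V \<subseteq> U"
    using neq assms(4) fin card_subset_eq by metis+
  then obtain x y where "x \<in> U" "x \<notin> V" "y \<in> V" "y \<notin> U" by auto
  then have "x < y" "y < x" using assms by auto
  then show False by simp
qed

section \<open>Removing a least element\<close>

text \<open>Every other member of \<open>N\<close> strictly extends \<open>r\<close>, so the labels
  of \<open>r\<close> are forced to be the initial segment of size \<open>k\<close>, and deleting
  \<open>r\<close> loses no information.\<close>

lemma card_prefix_labellings_remove_min:
  fixes N :: "'a list set"
  assumes "finite N" "finite S" "card S = k * card N"
    and r: "r \<in> N" "\<And>w. w \<in> N \<Longrightarrow> prefix r w"
  shows "\<exists>U\<subseteq>S. card U = k \<and>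
    card (prefix_labellings k N S) = card (prefix_labellings k (N - {r}) (S - U))"
proof -
  have "card N > 0" using assms by (auto simp: card_gt_0_iff)
  then have "k \<le> card S" using assms(3) by simp
  then obtain U where U: "U \<subseteq> S" "card U = k" "\<forall>a\<in>U. \<forall>b\<in>S - U. a < b"
    using exists_initial_segment \<open>finite S\<close> by blast
  \<comment> \<open>A label outside \<open>L r\<close> sits at some other \<open>w\<close>, because
    the labels exhaust \<open>S\<close>, and \<open>r\<close> is a strict prefix of
    \<open>w\<close>. So \<open>L r\<close> is an initial segment and uniqueness applies.\<close>
  have Lr: "L r = U" if L: "L \<in> prefix_labellings k N S" for L
  proof (rule initial_segment_unique[OF \<open>finite S\<close>])
    show "L r \<subseteq> S" "card (L r) = card U"
      using L r U(2) by (auto simp: prefix_labellings_def dest!: PiE_mem)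
    show "\<forall>a\<in>L r. \<forall>b\<in>S - L r. a < b"
    proof (intro ballI)
      fix a b assume a: "a \<in> L r" and b: "b \<in> S - L r"
      then obtain w where w: "w \<in> N" "b \<in> L w" "w \<noteq> r"
        using L by (auto simp: prefix_labellings_def)
      then have "strict_prefix r w" using r by (auto simp: strict_prefix_def)
      then show "a < b" using L w r a by (auto simp: prefix_labellings_def)
    qed
  qed (use U in auto)
  have "bij_betw (\<lambda>L. restrict L (N - {r}))
     (prefix_labellings k N S) (prefix_labellings k (N - {r}) (S - U))"
  proof (rule bij_betw_byWitness[where f' = "\<lambda>L. L(r := U)"])
    \<comment> \<open>Restriction forgets only the value at \<open>r\<close>, which
      \<open>Lr\<close> recovers; off \<open>N\<close> both sides are
      \<open>undefined\<close>.\<close>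
    show "\<forall>L\<in>prefix_labellings k N S. (restrict L (N - {r}))(r := U) = L"
    proof
      fix L assume L: "L \<in> prefix_labellings k N S"
      show "(restrict L (N - {r}))(r := U) = L"
        by (rule ext) (simp add: Lr[OF L] prefix_labellings_undefined[OF L])
    qed
    show "\<forall>L\<in>prefix_labellings k (N - {r}) (S - U). restrict (L(r := U)) (N - {r}) = L"
    proof
      fix L assume L: "L \<in> prefix_labellings k (N - {r}) (S - U)"
      show "restrict (L(r := U)) (N - {r}) = L"
        by (rule ext) (simp add: restrict_def prefix_labellings_undefined[OF L])
    qed
    show "(\<lambda>L. restrict L (N - {r})) ` prefix_labellings k N S
      \<subseteq> prefix_labellings k (N - {r}) (S - U)"
    proof (rule image_subsetI)
      fix L assume L: "L \<in> prefix_labellings k N S"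
      have dis: "L v \<inter> U = {}" if "v \<in> N" "v \<noteq> r" for v
        using L that r(1) unfolding Lr[OF L, symmetric]
        by (simp add: prefix_labellings_def disjoint_family_on_def)
      have un: "(\<Union>v\<in>N. L v) = S" using L by (simp add: prefix_labellings_def)
      have "(\<Union>v\<in>N - {r}. L v) = S - U"
      proof -
        have "(\<Union>v\<in>N. L v) = L r \<union> (\<Union>v\<in>N - {r}. L v)" using r by auto
        moreover have "(\<Union>v\<in>N - {r}. L v) \<inter> U = {}" using dis by auto
        ultimately show ?thesis using un Lr[OF L] by blast
      qed
      then show "restrict L (N - {r}) \<in> prefix_labellings k (N - {r}) (S - U)"
        using restrict_prefix_labellings[OF L, of "N - {r}"] by auto
    qed
    show "(\<lambda>L. L(r := U)) ` prefix_labellings k (N - {r}) (S - U) \<subseteq> prefix_labellings k N S"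
    proof (rule image_subsetI)
      fix L assume L: "L \<in> prefix_labellings k (N - {r}) (S - U)"
      have sub: "L v \<subseteq> S - U" "card (L v) = k" if "v \<in> N" "v \<noteq> r" for v
        using L that by (auto simp: prefix_labellings_def dest!: PiE_mem)
      have un: "(\<Union>v\<in>N - {r}. L v) = S - U" using L by (simp add: prefix_labellings_def)
      have "(\<Union>v\<in>N. (L(r := U)) v) = U \<union> (\<Union>v\<in>N - {r}. L v)" using r by auto
      then have "(\<Union>v\<in>N. (L(r := U)) v) = S" using un U by auto
      moreover have "L(r := U) \<in> N \<rightarrow>\<^sub>E {A. A \<subseteq> S \<and> card A = k}"
      proof (rule PiE_I)
        fix v assume "v \<in> N"
        then show "(L(r := U)) v \<in> {A. A \<subseteq> S \<and> card A = k}"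
          using sub[of v] U by auto
      next
        fix v assume "v \<notin> N"
        then show "(L(r := U)) v = undefined"
          using r by (auto simp: prefix_labellings_undefined[OF L])
      qed
      moreover have "disjoint_family_on (L(r := U)) N"
        unfolding disjoint_family_on_def
      proof (intro ballI impI)
        fix v w assume vw: "v \<in> N" "w \<in> N" "v \<noteq> w"
        consider "v = r" | "w = r" | "v \<noteq> r" "w \<noteq> r" by blast
        then show "(L(r := U)) v \<inter> (L(r := U)) w = {}"
        proof cases
          case 1
          then show ?thesis using vw sub(1)[of w] by auto
        next
          case 2
          then show ?thesis using vw sub(1)[of v] by auto
        next
          case 3
          then show ?thesis
            using vw L by (simp add: prefix_labellings_def disjoint_family_on_def)
        qed
      qed
      moreover have "a < b"
        if vw: "v \<in> N" "w \<in> N" "strict_prefix v w"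
          and ab: "a \<in> (L(r := U)) v" "b \<in> (L(r := U)) w" for v w a b
      proof -
        \<comment> \<open>Since \<open>r\<close> is a prefix of \<open>v\<close>, it cannot strictly
          extend \<open>v\<close>; thus \<open>r\<close> occurs only as the lower node of a
          pair.\<close>
        have "w \<noteq> r" using vw r(2)[of v] by auto
        show ?thesis
        proof (cases "v = r")
          case True
          then show ?thesis using ab \<open>w \<noteq> r\<close> sub(1)[OF \<open>w \<in> N\<close>] U(3) by auto
        next
          case False
          then show ?thesis using ab vw \<open>w \<noteq> r\<close> L by (simp add: prefix_labellings_def)
        qed
      qed
      ultimately show "L(r := U) \<in> prefix_labellings k N S"
        unfolding prefix_labellings_def by blast
    qed
  qed
  then show ?thesis using U bij_betw_same_card by blast
qed

section \<open>Splitting into two incomparable parts\<close>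

text \<open>Once the set \<open>U\<close> of labels used on \<open>A\<close> is fixed,
  \<open>B\<close> must use \<open>S - U\<close>. No order condition links the two parts, so they
  are labelled independently and any two labellings can be glued.\<close>

lemma bij_betw_prefix_labellings_Un:
  fixes A B :: "'a list set"
  assumes AB: "A \<inter> B = {}"
    and incomp: "\<And>a b. a \<in> A \<Longrightarrow> b \<in> B \<Longrightarrow> \<not> prefix a b \<and> \<not> prefix b a"
    and "U \<subseteq> S"
  shows "bij_betw (\<lambda>L. (restrict L A, restrict L B))
     {L \<in> prefix_labellings k (A \<union> B) S. (\<Union>v\<in>A. L v) = U}
     (prefix_labellings k A U \<times> prefix_labellings k B (S - U))"
proof (rule bij_betw_byWitness[where f' = "\<lambda>(L, M) v. if v \<in> A then L v else M v"])
  show "\<forall>L\<in>{L \<in> prefix_labellings k (A \<union> B) S. (\<Union>v\<in>A. L v) = U}.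
      (case (restrict L A, restrict L B) of (L, M) \<Rightarrow> \<lambda>v. if v \<in> A then L v else M v) = L"
  proof
    fix L assume "L \<in> {L \<in> prefix_labellings k (A \<union> B) S. (\<Union>v\<in>A. L v) = U}"
    then have L: "L \<in> prefix_labellings k (A \<union> B) S" by simp
    show "(case (restrict L A, restrict L B) of (L, M) \<Rightarrow> \<lambda>v. if v \<in> A then L v else M v) = L"
      by (rule ext) (simp add: prefix_labellings_undefined[OF L])
  qed
  show "\<forall>p\<in>prefix_labellings k A U \<times> prefix_labellings k B (S - U).
      (restrict (case p of (L, M) \<Rightarrow> \<lambda>v. if v \<in> A then L v else M v) A,
       restrict (case p of (L, M) \<Rightarrow> \<lambda>v. if v \<in> A then L v else M v) B) = p"
  proof
    fix p assume "p \<in> prefix_labellings k A U \<times> prefix_labellings k B (S - U)"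
    then obtain L M where p: "p = (L, M)" and L: "L \<in> prefix_labellings k A U"
      and M: "M \<in> prefix_labellings k B (S - U)" by auto
    have "restrict (\<lambda>v. if v \<in> A then L v else M v) A = L"
      by (rule ext) (simp add: prefix_labellings_undefined[OF L])
    moreover have "restrict (\<lambda>v. if v \<in> A then L v else M v) B = M"
    proof
      fix v show "restrict (\<lambda>v. if v \<in> A then L v else M v) B v = M v"
        using AB by (cases "v \<in> B") (auto simp: prefix_labellings_undefined[OF M])
    qed
    ultimately show "(restrict (case p of (L, M) \<Rightarrow> \<lambda>v. if v \<in> A then L v else M v) A,
        restrict (case p of (L, M) \<Rightarrow> \<lambda>v. if v \<in> A then L v else M v) B) = p"
      by (simp add: p)
  qed
  show "(\<lambda>L. (restrict L A, restrict L B)) `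
      {L \<in> prefix_labellings k (A \<union> B) S. (\<Union>v\<in>A. L v) = U}
    \<subseteq> prefix_labellings k A U \<times> prefix_labellings k B (S - U)"
  proof (rule image_subsetI)
    fix L assume "L \<in> {L \<in> prefix_labellings k (A \<union> B) S. (\<Union>v\<in>A. L v) = U}"
    then have L: "L \<in> prefix_labellings k (A \<union> B) S" and LU: "(\<Union>v\<in>A. L v) = U" by auto
    have dis: "L v \<inter> L w = {}" if "v \<in> A \<union> B" "w \<in> A \<union> B" "v \<noteq> w" for v w
      using L that by (simp add: prefix_labellings_def disjoint_family_on_def)
    have "(\<Union>v\<in>A \<union> B. L v) = S" using L by (simp add: prefix_labellings_def)
    then have "U \<union> (\<Union>v\<in>B. L v) = S" using LU by (simp add: UN_Un)
    moreover have "U \<inter> (\<Union>v\<in>B. L v) = {}" using dis AB unfolding LU[symmetric] by blast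
    ultimately have LB: "(\<Union>v\<in>B. L v) = S - U" by blast
    show "(restrict L A, restrict L B) \<in>
        prefix_labellings k A U \<times> prefix_labellings k B (S - U)"
      using restrict_prefix_labellings[OF L, of A] restrict_prefix_labellings[OF L, of B] LU LB
      by auto
  qed
  show "(\<lambda>(L, M) v. if v \<in> A then L v else M v) `
      (prefix_labellings k A U \<times> prefix_labellings k B (S - U))
    \<subseteq> {L \<in> prefix_labellings k (A \<union> B) S. (\<Union>v\<in>A. L v) = U}"
  proof (rule image_subsetI)
    fix p assume "p \<in> prefix_labellings k A U \<times> prefix_labellings k B (S - U)"
    then obtain L M where p: "p = (L, M)" and L: "L \<in> prefix_labellings k A U"
      and M: "M \<in> prefix_labellings k B (S - U)" by auto
    \<comment> \<open>Off \<open>A\<close> the glued function follows \<open>M\<close>, so it is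
      automatically \<open>undefined\<close> off \<open>A \<union> B\<close>.\<close>
    define K where "K = (\<lambda>v. if v \<in> A then L v else M v)"
    have KA: "K v = L v" if "v \<in> A" for v using that by (simp add: K_def)
    have KB: "K v = M v" if "v \<in> B" for v using that AB by (auto simp: K_def)
    have LU: "(\<Union>v\<in>A. K v) = U" using L KA by (simp add: prefix_labellings_def)
    have MU: "(\<Union>v\<in>B. K v) = S - U" using M KB by (simp add: prefix_labellings_def)
    have un: "(\<Union>v\<in>A \<union> B. K v) = S" using LU MU \<open>U \<subseteq> S\<close> by (auto simp: UN_Un)
    have card: "card (K v) = k" if "v \<in> A \<union> B" for v
      using that
    proof
      assume "v \<in> A"
      then show ?thesis using L unfolding KA[OF \<open>v \<in> A\<close>] prefix_labellings_def
        by (blast dest: PiE_mem)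
    next
      assume "v \<in> B"
      then show ?thesis using M unfolding KB[OF \<open>v \<in> B\<close>] prefix_labellings_def
        by (blast dest: PiE_mem)
    qed
    have "K \<in> A \<union> B \<rightarrow>\<^sub>E {X. X \<subseteq> S \<and> card X = k}"
    proof (rule PiE_I)
      fix v assume "v \<in> A \<union> B"
      then show "K v \<in> {X. X \<subseteq> S \<and> card X = k}" using un card by blast
    next
      fix v assume "v \<notin> A \<union> B"
      then show "K v = undefined"
        by (simp add: K_def prefix_labellings_undefined[OF M])
    qed
    moreover have "disjoint_family_on K (A \<union> B)"
      unfolding disjoint_family_on_def
    proof (intro ballI impI)
      fix v w assume vw: "v \<in> A \<union> B" "w \<in> A \<union> B" "v \<noteq> w"
      have "K v \<inter> K w = {}" if "v \<in> A" "w \<in> A"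
        using that vw L KA by (simp add: prefix_labellings_def disjoint_family_on_def)
      moreover have "K v \<inter> K w = {}" if "v \<in> B" "w \<in> B"
        using that vw M KB by (simp add: prefix_labellings_def disjoint_family_on_def)
      moreover have "K v \<inter> K w = {}" if "v \<in> A" "w \<in> B"
        using that LU MU by blast
      moreover have "K v \<inter> K w = {}" if "v \<in> B" "w \<in> A"
        using that LU MU by blast
      ultimately show "K v \<inter> K w = {}" using vw by blast
    qed
    moreover have "a < b"
      if vw: "v \<in> A \<union> B" "w \<in> A \<union> B" "strict_prefix v w"
        and ab: "a \<in> K v" "b \<in> K w" for v w a b
    proof -
      \<comment> \<open>Incomparability rules out mixed pairs, so each order condition on
        \<open>K\<close> comes from \<open>L\<close> alone or from \<open>M\<close> alone.\<close>
      have "v \<in> A \<and> w \<in> A \<or> v \<in> B \<and> w \<in> B"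
        using vw incomp by (auto simp: strict_prefix_def)
      then show ?thesis
      proof (elim disjE conjE)
        assume "v \<in> A" "w \<in> A"
        then show ?thesis using ab KA L vw by (simp add: prefix_labellings_def)
      next
        assume "v \<in> B" "w \<in> B"
        then show ?thesis using ab KB M vw by (simp add: prefix_labellings_def)
      qed
    qed
    ultimately have "K \<in> prefix_labellings k (A \<union> B) S"
      using un unfolding prefix_labellings_def by blast
    then show "(case p of (L, M) \<Rightarrow> \<lambda>v. if v \<in> A then L v else M v)
        \<in> {L \<in> prefix_labellings k (A \<union> B) S. (\<Union>v\<in>A. L v) = U}"
      using LU by (simp add: p K_def[symmetric])
  qed
qed

text \<open>Labellings are sorted by the set of labels that they use on \<open>A\<close>, a disjoint
  union of sets of size \<open>k\<close>; the preceding bijection turns each class into a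
  product.\<close>

lemma card_prefix_labellings_Un:
  fixes A B :: "'a list set"
  assumes fin: "finite A" "finite B" "finite S" and AB: "A \<inter> B = {}"
    and incomp: "\<And>a b. a \<in> A \<Longrightarrow> b \<in> B \<Longrightarrow> \<not> prefix a b \<and> \<not> prefix b a"
  shows "card (prefix_labellings k (A \<union> B) S) =
    (\<Sum>U | U \<subseteq> S \<and> card U = k * card A.
       card (prefix_labellings k A U) * card (prefix_labellings k B (S - U)))"
proof -
  let ?P = "\<lambda>U. {L \<in> prefix_labellings k (A \<union> B) S. (\<Union>v\<in>A. L v) = U}"
  let ?I = "{U. U \<subseteq> S \<and> card U = k * card A}"
  have "prefix_labellings k (A \<union> B) S = (\<Union>U\<in>?I. ?P U)"
  proof -
    have "(\<Union>v\<in>A. L v) \<in> ?I" if L: "L \<in> prefix_labellings k (A \<union> B) S" for L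
    proof -
      have sub: "L v \<subseteq> S" "card (L v) = k" if "v \<in> A \<union> B" for v
        using L that unfolding prefix_labellings_def by (blast dest: PiE_mem)+
      have "card (\<Union>v\<in>A. L v) = (\<Sum>v\<in>A. card (L v))"
      proof (rule card_UN_disjoint[OF fin(1)])
        show "\<forall>i\<in>A. finite (L i)" using sub fin(3) finite_subset by blast
        show "\<forall>i\<in>A. \<forall>j\<in>A. i \<noteq> j \<longrightarrow> L i \<inter> L j = {}"
          using L by (simp add: prefix_labellings_def disjoint_family_on_def)
      qed
      also have "\<dots> = k * card A" using sub by simp
      finally show ?thesis using sub by blast
    qed
    then show ?thesis by blast
  qed
  moreover have "card (\<Union>U\<in>?I. ?P U) = (\<Sum>U\<in>?I. card (?P U))"
    using fin by (intro card_UN_disjoint) (auto simp: finite_prefix_labellings)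
  moreover have "card (?P U) =
      card (prefix_labellings k A U) * card (prefix_labellings k B (S - U))" if "U \<in> ?I" for U
    using bij_betw_same_card[OF bij_betw_prefix_labellings_Un[OF AB incomp, of U S k]] that
    by (simp add: card_cartesian_product)
  ultimately show ?thesis by simp
qed

section \<open>The hook length formula for the prefix order\<close>

text \<open>Strong induction on the size of \<open>N\<close>, for all \<open>S\<close> at once,
  since both ways of shrinking \<open>N\<close> change the label set. The product form requires no
  argument that the falling factorials are nonzero.\<close>

lemma hook_length_formula_prefix:
  fixes N :: "'a list set"
  assumes "finite N" "finite S" "card S = k * card N"
  shows "real (card (prefix_labellings k N S)) *
    (\<Prod>v\<in>N. falling_fact (real (k * card {w \<in> N. prefix v w})) k) = fact (k * card N)"
  using assms
proof (induction "card N" arbitrary: N S rule: less_induct)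
  case less
  show ?case
  proof (cases "N = {}")
    case True
    \<comment> \<open>Here \<open>S\<close> is empty too, and the only extensional function on the
      empty set is constantly \<open>undefined\<close>; the count 1 matches
      \<open>fact 0\<close>.\<close>
    then have "prefix_labellings k N S = {\<lambda>_. undefined}"
      using less.prems by (auto simp: prefix_labellings_def disjoint_family_on_def)
    then show ?thesis using True by simp
  next
    case False
    then obtain r where r: "r \<in> N" "\<And>w. w \<in> N \<Longrightarrow> length r \<le> length w"
      using arg_min_if_finite[OF less.prems(1), of length] by (metis leI)
    define A where "A = {w \<in> N. prefix r w}"
    define B where "B = N - A"
    let ?h = "\<lambda>N v. falling_fact (real (k * card {w \<in> N. prefix v w})) k"
    have fin: "finite A" "finite B" using less.prems by (auto simp: A_def B_def)
    have N: "N = A \<union> B" "A \<inter> B = {}" by (auto simp: A_def B_def)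
    have rA: "r \<in> A" using r by (simp add: A_def)
    have incomp: "\<not> prefix a b \<and> \<not> prefix b a" if "a \<in> A" "b \<in> B" for a b
    proof
      show "\<not> prefix a b"
        using that by (auto simp: A_def B_def dest: prefix_order.trans)
      \<comment> \<open>Both \<open>r\<close> and \<open>b\<close> would be prefixes of
        \<open>a\<close>, hence comparable, and \<open>r\<close> is not longer by its choice; so
        \<open>b\<close> would extend \<open>r\<close> and lie in \<open>A\<close>.\<close>
      show "\<not> prefix b a"
      proof
        assume "prefix b a"
        moreover have "prefix r a" using that by (simp add: A_def)
        ultimately have "prefix r b"
          using r(2)[of b] that by (auto simp: B_def intro: prefix_length_prefix)
        then show False using that by (simp add: A_def B_def)
      qed
    qed
    show ?thesis
    proof (cases "B = {}")
      case True
      then have NA: "N = A" using N by simp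
      have rmin: "prefix r w" if "w \<in> N" for w using that NA A_def by blast
      obtain U where U: "U \<subseteq> S" "card U = k"
        "card (prefix_labellings k N S) = card (prefix_labellings k (N - {r}) (S - U))"
        using card_prefix_labellings_remove_min[OF less.prems r(1) rmin] by blast
      have cN: "card N = Suc (card (N - {r}))"
        using less.prems(1) r(1) by (metis card_Suc_Diff1)
      have cS: "card (S - U) = k * card (N - {r})"
        using U less.prems cN finite_subset[OF U(1)] by (simp add: card_Diff_subset)
      \<comment> \<open>The hook of \<open>r\<close> is all of \<open>N\<close>, and deleting
        \<open>r\<close> changes no other hook because \<open>r\<close> extends none of the
        remaining elements.\<close>
      have hr: "{w \<in> N. prefix r w} = N" using rmin by auto
      have hM: "{w \<in> N. prefix v w} = {w \<in> N - {r}. prefix v w}" if "v \<in> N - {r}" for v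
        using that rmin[of v] by (auto dest: prefix_order.antisym)
      have "(\<Prod>v\<in>N. ?h N v) = ?h N r * (\<Prod>v\<in>N - {r}. ?h N v)"
        using less.prems(1) r(1) by (rule prod.remove)
      also have "(\<Prod>v\<in>N - {r}. ?h N v) = (\<Prod>v\<in>N - {r}. ?h (N - {r}) v)"
        by (intro prod.cong refl) (simp only: hM)
      finally have prod: "(\<Prod>v\<in>N. ?h N v) =
          falling_fact (real (k * card N)) k * (\<Prod>v\<in>N - {r}. ?h (N - {r}) v)"
        unfolding hr .
      have IH: "real (card (prefix_labellings k (N - {r}) (S - U))) *
          (\<Prod>v\<in>N - {r}. ?h (N - {r}) v) = fact (k * card (N - {r}))"
        using less.prems cN cS by (intro less.hyps) auto
      have "real (card (prefix_labellings k N S)) * (\<Prod>v\<in>N. ?h N v) =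
          falling_fact (real (k * card N)) k * fact (k * card (N - {r}))"
        unfolding prod U(3) IH[symmetric] by (simp only: ac_simps)
      also have "k * card (N - {r}) = k * card N - k" using cN by simp
      also have "falling_fact (real (k * card N)) k * fact (k * card N - k) = fact (k * card N)"
        using cN by (intro falling_fact_mult_fact) simp
      finally show ?thesis .
    next
      case False
      have cN: "card N = card A + card B" using N fin by (simp add: card_Un_disjoint)
      \<comment> \<open>As both parts are nonempty, each is strictly smaller than \<open>N\<close>
        and the induction hypothesis applies to it.\<close>
      have pos: "card A > 0" "card B > 0" using fin False rA by (auto simp: card_gt_0_iff)
      \<comment> \<open>By incomparability, hooks stay inside their part.\<close>
      have hA: "{w \<in> N. prefix v w} = {w \<in> A. prefix v w}" if "v \<in> A" for v
        using that incomp N by auto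
      have hB: "{w \<in> N. prefix v w} = {w \<in> B. prefix v w}" if "v \<in> B" for v
        using that incomp N by auto
      have "(\<Prod>v\<in>N. ?h N v) = (\<Prod>v\<in>A. ?h N v) * (\<Prod>v\<in>B. ?h N v)"
        unfolding N(1) using fin N(2) by (rule prod.union_disjoint)
      also have "(\<Prod>v\<in>A. ?h N v) = (\<Prod>v\<in>A. ?h A v)"
        by (intro prod.cong refl) (simp only: hA)
      also have "(\<Prod>v\<in>B. ?h N v) = (\<Prod>v\<in>B. ?h B v)"
        by (intro prod.cong refl) (simp only: hB)
      finally have prod: "(\<Prod>v\<in>N. ?h N v) = (\<Prod>v\<in>A. ?h A v) * (\<Prod>v\<in>B. ?h B v)" .
      let ?I = "{U. U \<subseteq> S \<and> card U = k * card A}"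
      \<comment> \<open>The value does not depend on \<open>U\<close>, because the induction
        hypothesis covers every label set of the right size. The sum then only counts the choices of
        \<open>U\<close>, which gives the binomial coefficient.\<close>
      have summand: "real (card (prefix_labellings k A U) * card (prefix_labellings k B (S - U)))
          * ((\<Prod>v\<in>A. ?h A v) * (\<Prod>v\<in>B. ?h B v)) = fact (k * card A) * fact (k * card B)"
        if U: "U \<in> ?I" for U
      proof -
        have finU: "finite U" using U less.prems(2) finite_subset by blast
        then have "card (S - U) = k * card B"
          using U less.prems(3) cN by (simp add: card_Diff_subset algebra_simps)
        then have "real (card (prefix_labellings k B (S - U))) * (\<Prod>v\<in>B. ?h B v)
            = fact (k * card B)"
          using fin pos cN less.prems(2) by (intro less.hyps) auto
        moreover have "real (card (prefix_labellings k A U)) * (\<Prod>v\<in>A. ?h A v)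
            = fact (k * card A)"
          using fin pos cN finU U by (intro less.hyps) auto
        ultimately show ?thesis
          by (metis (no_types, lifting) mult.assoc mult.left_commute of_nat_mult)
      qed
      have "card (prefix_labellings k N S) = (\<Sum>U\<in>?I.
          card (prefix_labellings k A U) * card (prefix_labellings k B (S - U)))"
        unfolding N(1) by (rule card_prefix_labellings_Un[OF fin less.prems(2) N(2) incomp])
      then have "real (card (prefix_labellings k N S)) * (\<Prod>v\<in>N. ?h N v) =
          (\<Sum>U\<in>?I. real (card (prefix_labellings k A U) * card (prefix_labellings k B (S - U)))
            * ((\<Prod>v\<in>A. ?h A v) * (\<Prod>v\<in>B. ?h B v)))"
        unfolding prod by (simp only: of_nat_sum sum_distrib_right)
      also have "\<dots> = (\<Sum>U\<in>?I. fact (k * card A) * fact (k * card B))"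
        by (intro sum.cong refl summand)
      also have "\<dots> = real ((k * card N) choose (k * card A)) *
          (fact (k * card A) * fact (k * card B))"
        using n_subsets[OF less.prems(2), of "k * card A"] less.prems(3) by simp
      also have "\<dots> = fact (k * card N)"
        using binomial_fact_lemma[of "k * card A" "k * card N"] cN
        by (metis (no_types, lifting) add_diff_cancel_left' add_mult_distrib2 le_add1 mult.commute
            of_nat_fact of_nat_mult)
      finally show ?thesis .
    qed
  qed
qed

section \<open>From the prefix order back to trees\<close>

lemma nodes_append_closed: "v @ u \<in> nodes t \<Longrightarrow> v \<in> nodes t"
proof (induction v arbitrary: t)
  case Nil
  then show ?case by (cases t) simp
next
  case (Cons i v)
  then show ?case by (cases t) auto
qed

text \<open>The comparison of parent and child spreads to all descendants by transitivity along the
  connecting path. This passes through a label at each inner node, which \<open>k \<ge> 1\<close>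
  supplies.\<close>

lemma increasing_labellings_eq_prefix_labellings:
  assumes "k \<ge> 1"
  shows "increasing_labellings k t = prefix_labellings k (nodes t) {1..k * card (nodes t)}"
proof -
  have "(\<forall>v i. v @ [i] \<in> nodes t \<longrightarrow> (\<forall>a\<in>L v. \<forall>b\<in>L (v @ [i]). a < b)) \<longleftrightarrow>
      (\<forall>v\<in>nodes t. \<forall>w\<in>nodes t. strict_prefix v w \<longrightarrow> (\<forall>a\<in>L v. \<forall>b\<in>L w. a < b))"
    (is "?child \<longleftrightarrow> ?desc")
    if L: "L \<in> nodes t \<rightarrow>\<^sub>E {A. A \<subseteq> {1..k * card (nodes t)} \<and> card A = k}" for L
  proof
    assume child: ?child
    have ne: "L v \<noteq> {}" if "v \<in> nodes t" for v
      using PiE_mem[OF L that] assms by auto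
    \<comment> \<open>The path \<open>u\<close> below \<open>v\<close> grows at its end, so that the
      last step is a parent-child pair.\<close>
    have desc: "\<forall>a\<in>L v. \<forall>b\<in>L (v @ u). a < b" if "v @ u \<in> nodes t" "u \<noteq> []" for v u
      using that
    proof (induction u rule: rev_induct)
      case (snoc i u)
      have vu: "v @ u \<in> nodes t" using snoc.prems nodes_append_closed[of "v @ u" "[i]"] by simp
      have step: "\<forall>a\<in>L (v @ u). \<forall>b\<in>L (v @ u @ [i]). a < b"
        using child[rule_format, of "v @ u" i] snoc.prems by simp
      show ?case
      proof (cases "u = []")
        case False
        from ne[OF vu] obtain c where "c \<in> L (v @ u)" by auto
        then show ?thesis using snoc.IH[OF vu False] step by (meson less_trans)
      qed (use step in simp)
    qed simp
    show ?desc
      using desc by (auto simp: strict_prefix_def prefix_def)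
  next
    assume ?desc
    moreover have "strict_prefix v (v @ [i])" for v :: "nat list" and i
      by (simp add: strict_prefix_def)
    ultimately show ?child
      using nodes_append_closed by blast
  qed
  then show ?thesis
    unfolding increasing_labellings_def prefix_labellings_def
    by (intro Collect_cong conj_cong refl) simp
qed

lemma hook_length_formula:
  assumes "k \<ge> 1"
  shows "real (card (increasing_labellings k t)) *
    (\<Prod>v\<in>nodes t. falling_fact (real (k * num_desc t v)) k) = fact (k * card (nodes t))"
  unfolding increasing_labellings_eq_prefix_labellings[OF assms] num_desc_def
  by (rule hook_length_formula_prefix) (simp_all add: finite_nodes)

section \<open>Summation over ordered trees\<close>

theorem theorem6p2:
  fixes k n :: nat and \<phi> :: "nat \<Rightarrow> real"
  assumes "k \<ge> 1" and "n \<ge> 1"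
    and "\<And>j. \<phi> j \<ge> 0" and "\<phi> 0 > 0"
  shows "(\<Sum>t\<in>ordered_trees n. \<Prod>v\<in>nodes t.
            \<phi> (outdeg t v) / falling_fact (real (k * num_desc t v)) k)
         = total_weight k \<phi> n / fact (k * n)"
  unfolding total_weight_def sum_divide_distrib
proof (intro sum.cong refl)
  fix t assume "t \<in> ordered_trees n"
  then have hook: "real (card (increasing_labellings k t)) *
      (\<Prod>v\<in>nodes t. falling_fact (real (k * num_desc t v)) k) = fact (k * n)" (is "?c * ?P = _")
    using hook_length_formula[OF assms(1), of t] by (simp add: ordered_trees_def)
  \<comment> \<open>The identity holds tree by tree: with \<open>fact (k * n)\<close> rewritten as
    \<open>?c * ?P\<close>, the factor \<open>?c\<close> cancels, being nonzero as a divisor of a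
    factorial in this product.\<close>
  then have "?c \<noteq> 0" by (metis fact_nonzero mult_zero_left)
  then show "(\<Prod>v\<in>nodes t. \<phi> (outdeg t v) / falling_fact (real (k * num_desc t v)) k) =
      (\<Prod>v\<in>nodes t. \<phi> (outdeg t v)) * ?c / fact (k * n)"
    unfolding prod_dividef hook[symmetric] by simp
qed

end
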